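(* Let $q=p$ be an odd prime, and let $P(X,Z)\in\mathbb{F}_q[X,Z]$ be monic in $Z$ with $\deg_Z P\ge 2$. Suppose that $P(0,Z)$ has exactly $r$ distinct roots in $\mathbb{F}_q$. Let $$Q(X,Y,Z)=XQ_1(X,Y,Z)+Y^2+b(Z)Y+c(Z),$$ where $Q_1(X,Y,Z)\in\mathbb{F}_q[X,Y,Z]$, $b(Z),c(Z)\in\mathbb{F}_q[Z]$, and $\deg_Y Q_1<2$. For each $\gamma\in\mathbb{F}_q$ set $D(\gamma)=c(\gamma)-\frac{b(\gamma)^2}{4}$, and let $$N_0'=\#\{(\beta,\gamma)\in\mathbb{F}_q^2\mid P(0,\gamma)=0,\ Q(0,\beta,\gamma)=0\}.$$ Then $$N_0'=r+\eta(-1)\sum_{\substack{\gamma\in\mathbb{F}_q\\ P(0,\gamma)=0}}\eta(D(\gamma)).$$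
   Context: $\eta$ is the quadratic character of $\mathbb{F}_q$ ($q$ odd): $\eta(a)=1$ if $a$ is a nonzero square, $\eta(a)=-1$ if $a$ is a nonsquare, and $\eta(0)=0$. "Monic in $Z$" means leading coefficient $1$ as a polynomial in $Z$ over the polynomial ring in the other variables. *)

theory Defs
  imports "HOL-Computational_Algebra.Computational_Algebra" "HOL-Library.Cardinality"
begin

definition quad_char :: "'a :: field \<Rightarrow> int" where
  "quad_char a = (if a = 0 then 0 else if \<exists>x. a = x ^ 2 then 1 else - 1)"

(* The ring F[X,Z] is represented as F[X][Z], i.e. as 'a poly poly whose outer variable is Z, and
   F[X,Y,Z] as F[X][Z][Y], i.e. as 'a poly poly poly whose outer variable is Y. Hence
   degree and lead_coeff refer to Z in the first case and to Y in the second. *)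

definition eval_XZ :: "'a :: field poly poly \<Rightarrow> 'a \<Rightarrow> 'a \<Rightarrow> 'a" where
  "eval_XZ P x z = poly (poly P [:z:]) x"

definition eval_XYZ :: "'a :: field poly poly poly \<Rightarrow> 'a \<Rightarrow> 'a \<Rightarrow> 'a \<Rightarrow> 'a" where
  "eval_XYZ Q x y z = poly (poly (poly Q [:[:y:]:]) [:z:]) x"

(* the univariate polynomial P(x,Z) *)
definition subst_X :: "'a :: field \<Rightarrow> 'a poly poly \<Rightarrow> 'a poly" where
  "subst_X x P = map_poly (\<lambda>f. poly f x) P"

definition var_X :: "'a :: field poly poly poly" where
  "var_X = [:[:[:0, 1:]:]:]"

definition var_Y :: "'a :: field poly poly poly" where
  "var_Y = [:0, 1:]"

(* the inclusion of F[Z] into F[X][Z][Y] *)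
definition of_poly_Z :: "'a :: field poly \<Rightarrow> 'a poly poly poly" where
  "of_poly_Z f = [:map_poly (\<lambda>a. [:a:]) f:]"

end

theory Submission
  imports Defs "HOL-Number_Theory.Residues"
begin

text \<open>
  At \<open>X = 0\<close> the equation \<open>Q = 0\<close> becomes \<open>(Y + b/2)\<^sup>2 = -D\<close>, which has \<open>1 + \<eta>(-D)\<close> solutions
  over each root of \<open>P(0,Z)\<close>, and \<open>\<eta>(-D) = \<eta>(-1) \<eta>(D)\<close>.
\<close>

text \<open>The characteristic divides the cardinality, so characteristic 2 would make the
  cardinality even.\<close>

lemma two_neq_zero_if_odd_card:
  assumes "odd (CARD('a :: {field, finite}))"
  shows "(2 :: 'a) \<noteq> 0"
proof
  assume "(2 :: 'a) = 0"
  then have "of_nat 2 = (0 :: 'a)"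
    by simp
  then have "CHAR('a) dvd 2"
    using of_nat_eq_0_iff_char_dvd by blast
  moreover have "CHAR('a) \<noteq> 1"
    by simp
  ultimately have "CHAR('a) = 2"
    using prime_nat_iff two_is_prime_nat by blast
  then show False
    using CHAR_dvd_CARD[where 'a = 'a] assms by auto
qed

lemma square_roots_eq:
  fixes a x :: "'a :: idom"
  assumes "a = x ^ 2"
  shows "{y. y ^ 2 = a} = {x, - x}"
  using assms by (auto simp: power2_eq_iff)

text \<open>If \<open>a\<close> is a square, its roots are \<open>x\<close> and \<open>- x\<close>,
  which coincide only for \<open>x = 0\<close> because 2 is invertible.\<close>

lemma card_square_roots:
  fixes a :: "'a :: field"
  assumes "(2 :: 'a) \<noteq> 0"
  shows "int (card {y. y ^ 2 = a}) = 1 + quad_char a"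
proof (cases "\<exists>x. a = x ^ 2")
  case True
  then obtain x where x: "a = x ^ 2"
    by blast
  have "2 * x = 0 \<longleftrightarrow> x = 0"
    using assms by simp
  then have "x = - x \<longleftrightarrow> x = 0"
    unfolding eq_neg_iff_add_eq_0 mult_2 .
  then have "card {x, - x} = (if x = 0 then 1 else 2)"
    by (simp add: card_insert_if)
  moreover have "quad_char a = (if x = 0 then 0 else 1)"
    using x by (auto simp: quad_char_def)
  ultimately show ?thesis
    unfolding square_roots_eq[OF x] by simp
next
  case False
  then have "{y. y ^ 2 = a} = {}"
    by auto
  moreover have "a \<noteq> 0"
    using False by (metis zero_power2)
  ultimately show ?thesis
    using False by (simp add: quad_char_def)
qed

text \<open>The fibres of squaring partition the field. Counting the field through them gives its
  cardinality plus the character sum.\<close>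

lemma sum_quad_char:
  assumes "(2 :: 'a :: {field, finite}) \<noteq> 0"
  shows "(\<Sum>a\<in>(UNIV :: 'a set). quad_char a) = 0"
proof -
  have "int (CARD('a)) = (\<Sum>a\<in>(UNIV :: 'a set). int (card {y. y ^ 2 = a}))"
    using sum_fun_comp[of "UNIV :: 'a set" UNIV "\<lambda>y. y ^ 2" "\<lambda>_. 1 :: int"] by simp
  also have "\<dots> = int (CARD('a)) + (\<Sum>a\<in>(UNIV :: 'a set). quad_char a)"
    by (simp add: card_square_roots[OF assms] sum.distrib)
  finally show ?thesis
    by simp
qed

lemma quad_char_mult_square:
  fixes a x :: "'a :: field"
  assumes "x \<noteq> 0"
  shows "quad_char (a * x ^ 2) = quad_char a"
proof -
  have "(\<exists>y. a * x ^ 2 = y ^ 2) \<longleftrightarrow> (\<exists>y. a = y ^ 2)"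
  proof
    assume "\<exists>y. a * x ^ 2 = y ^ 2"
    then obtain y where "a * x ^ 2 = y ^ 2"
      by blast
    then have "a = (y / x) ^ 2"
      using assms by (simp add: power_divide eq_divide_eq)
    then show "\<exists>y. a = y ^ 2"
      by blast
  qed (metis power_mult_distrib)
  then show ?thesis
    using assms by (simp add: quad_char_def)
qed

text \<open>
  For a nonsquare \<open>a\<close> all the terms \<open>\<eta>(x) + \<eta>(a x)\<close> are nonpositive, while their sum vanishes;
  hence each of them vanishes.
\<close>

lemma quad_char_mult_nonsquare:
  fixes a b :: "'a :: {field, finite}"
  assumes two: "(2 :: 'a) \<noteq> 0" and a: "quad_char a = - 1"
  shows "quad_char (a * b) = - quad_char b"
proof -
  \<comment> \<open>The sign makes the terms nonnegative, as \<open>sum_nonneg_eq_0_iff\<close>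
    requires.\<close>
  define f where "f x = - (quad_char x + quad_char (a * x))" for x :: 'a
  have a0: "a \<noteq> 0"
    using a by (auto simp: quad_char_def)
  \<comment> \<open>Multiplication by \<open>a\<close> permutes the field, so both halves of the sum
    of \<open>f\<close> vanish.\<close>
  have "bij ((*) a)"
    by (rule bij_betw_byWitness[where f' = "\<lambda>x. x / a"]) (use a0 in auto)
  then have "(\<Sum>x\<in>UNIV. quad_char (a * x)) = (\<Sum>x\<in>(UNIV :: 'a set). quad_char x)"
    by (rule sum.reindex_bij_betw)
  then have sum_f: "(\<Sum>x\<in>UNIV. f x) = 0"
    using sum_quad_char[OF two] by (simp add: f_def sum_negf sum_subtractf)
  have "f x \<ge> 0" for x
  \<comment> \<open>For a nonzero square \<open>x\<close>, the product \<open>a * x\<close> has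
    character -1. Otherwise \<open>x\<close> is 0 and both characters vanish, or \<open>x\<close> is
    a nonsquare and contributes -1 itself.\<close>
  proof (cases "x \<noteq> 0 \<and> (\<exists>y. x = y ^ 2)")
    case True
    then obtain y where y: "x = y ^ 2" "y \<noteq> 0"
      by auto
    then have "quad_char (a * x) = - 1"
      using quad_char_mult_square[of y a] a by simp
    moreover have "quad_char x \<le> 1"
      by (simp add: quad_char_def)
    ultimately show ?thesis
      by (simp add: f_def)
  next
    case False
    then show ?thesis
      by (auto simp: f_def quad_char_def)
  qed
  then have "f b = 0"
    using sum_f sum_nonneg_eq_0_iff[of UNIV f] by simp
  then show ?thesis
    by (simp add: f_def)
qed

lemma quad_char_mult:
  fixes a b :: "'a :: {field, finite}"
  assumes "(2 :: 'a) \<noteq> 0"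
  shows "quad_char (a * b) = quad_char a * quad_char b"
proof -
  consider "a = 0" | x where "a = x ^ 2" "x \<noteq> 0" | "quad_char a = - 1"
    by (metis quad_char_def zero_power2)
  then show ?thesis
  proof cases
    case 1
    then show ?thesis
      by (simp add: quad_char_def)
  next
    case 2
    then have "quad_char a = 1"
      by (auto simp: quad_char_def)
    then show ?thesis
      using 2 quad_char_mult_square[of x b] by (simp add: mult.commute)
  next
    case 3
    then show ?thesis
      using quad_char_mult_nonsquare[OF assms] by simp
  qed
qed

text \<open>Completing the square: the shift by \<open>b / 2\<close> maps the roots bijectively onto
  the square roots of minus a quarter of the discriminant.\<close>

lemma card_monic_quadratic_roots:
  fixes b c :: "'a :: field"
  assumes "(2 :: 'a) \<noteq> 0"
  shows "int (card {y. y ^ 2 + b * y + c = 0}) = 1 + quad_char (- (c - b ^ 2 / 4))"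
proof -
  have "b ^ 2 / 4 = (b / 2) ^ 2"
    by (simp add: power_divide)
  \<comment> \<open>This is the cross term in the shape that \<open>power2_sum\<close> and
    \<open>mult.assoc\<close> produce.\<close>
  moreover have "2 * (y * (b / 2)) = b * y" for y
    using assms by simp
  ultimately have "(y + b / 2) ^ 2 = y ^ 2 + b * y + b ^ 2 / 4" for y
    by (simp add: power2_sum mult.assoc add_ac)
  then have "y ^ 2 + b * y + c = 0 \<longleftrightarrow> (y + b / 2) ^ 2 = - (c - b ^ 2 / 4)" for y
    by (simp add: eq_neg_iff_add_eq_0)
  then have "{y. y ^ 2 + b * y + c = 0} = (\<lambda>y. y + b / 2) -` {z. z ^ 2 = - (c - b ^ 2 / 4)}"
    by auto
  moreover have "bij (\<lambda>y. y + b / 2)"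
    by (rule bij_betw_byWitness[where f' = "\<lambda>x. x - b / 2"]) auto
  ultimately have "card {y. y ^ 2 + b * y + c = 0} = card {z. z ^ 2 = - (c - b ^ 2 / 4)}"
    by (simp only: card_vimage_inj bij_is_inj bij_is_surj subset_UNIV)
  then show ?thesis
    using card_square_roots[OF assms] by simp
qed

text \<open>Reconciles the root set counted by \<open>r\<close> with the index set of the character
  sum.\<close>

lemma poly_subst_X: "poly (subst_X x P) z = eval_XZ P x z"
  unfolding subst_X_def eval_XZ_def
  by (induction P) (auto simp: map_poly_pCons)

lemma poly_map_poly_const: "poly (poly (map_poly (\<lambda>a. [:a:]) f) [:z:]) x = poly f z"
  by (induction f) (auto simp: map_poly_pCons)

theorem theorem4p36:
  fixes p r N0 :: nat
    and P :: "'a :: {field, finite} poly poly"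
    and Q Q1 :: "'a poly poly poly"
    and b c :: "'a poly"
    and D :: "'a \<Rightarrow> 'a"
  assumes "prime p" and "odd p" and "CARD('a) = p"
    and "lead_coeff P = 1" and "degree P \<ge> 2"
    and "card {\<gamma>. poly (subst_X 0 P) \<gamma> = 0} = r"
    and "Q = var_X * Q1 + var_Y ^ 2 + of_poly_Z b * var_Y + of_poly_Z c"
    and "degree Q1 < 2"
    and "\<And>\<gamma>. D \<gamma> = poly c \<gamma> - (poly b \<gamma>) ^ 2 / 4"
    and "N0 = card {(\<beta>, \<gamma>). eval_XZ P 0 \<gamma> = 0 \<and> eval_XYZ Q 0 \<beta> \<gamma> = 0}"
  shows "int N0 = int r + quad_char (- 1 :: 'a) * (\<Sum>\<gamma> | eval_XZ P 0 \<gamma> = 0. quad_char (D \<gamma>))"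
proof -
  define R where "R = {\<gamma>. eval_XZ P 0 \<gamma> = 0}"
  define F where "F \<gamma> = {\<beta>. \<beta> ^ 2 + poly b \<gamma> * \<beta> + poly c \<gamma> = 0}" for \<gamma>
  have two: "(2 :: 'a) \<noteq> 0"
    using two_neq_zero_if_odd_card assms(2,3) by blast
  \<comment> \<open>The factor at -1 splits off by writing \<open>- D \<gamma>\<close> as
    \<open>- 1 * D \<gamma>\<close>.\<close>
  have card_F: "int (card (F \<gamma>)) = 1 + quad_char (- 1 :: 'a) * quad_char (D \<gamma>)" for \<gamma>
    using quad_char_mult[OF two, of "- 1" "D \<gamma>"]
    by (simp add: F_def card_monic_quadratic_roots[OF two] assms(9))
  \<comment> \<open>At \<open>X = 0\<close> the summand with factor \<open>var_X\<close> vanishes,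
    which leaves a monic quadratic in \<open>Y\<close>.\<close>
  have "eval_XYZ Q 0 \<beta> \<gamma> = \<beta> ^ 2 + poly b \<gamma> * \<beta> + poly c \<gamma>" for \<beta> \<gamma>
    by (simp add: assms(7) eval_XYZ_def var_X_def var_Y_def of_poly_Z_def poly_map_poly_const)
  \<comment> \<open>The swap puts \<open>\<gamma>\<close> first, so that the solutions fibre over
    \<open>R\<close>.\<close>
  then have "{(\<beta>, \<gamma>). eval_XZ P 0 \<gamma> = 0 \<and> eval_XYZ Q 0 \<beta> \<gamma> = 0} = prod.swap ` Sigma R F"
    by (auto simp: R_def F_def image_iff)
  then have "N0 = card (Sigma R F)"
    using assms(10) by (simp add: card_image)
  then have "int N0 = (\<Sum>\<gamma>\<in>R. int (card (F \<gamma>)))"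
    by simp
  also have "\<dots> = int (card R) + quad_char (- 1 :: 'a) * (\<Sum>\<gamma>\<in>R. quad_char (D \<gamma>))"
    by (simp add: card_F sum.distrib sum_distrib_left)
  also have "card R = r"
    using assms(6) by (simp add: R_def poly_subst_X)
  finally show ?thesis
    by (simp add: R_def)
qed

end
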